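(* Let $f\in\mathbb{R}[x_1,\dots,x_n]$, let $\mathbf{N}=(N_1,\dots,N_n)$ with $N_i>0$ for $i=1,\dots,n$, let $d$ be an even integer with $d\ge\max\{2,\deg f\}$, and let $\mathbf{g}=\left(1-\left(\frac{x_1}{N_1}\right)^d,\dots,1-\left(\frac{x_n}{N_n}\right)^d\right)$. Then: (1) $s(f,\mathbf{g})\ge f_{\mathrm{tr},\mathbf{N}}$. (2) If $f_{d,i}\le0$ for $i=1,\dots,n$, then $s(f,\mathbf{g})=f_{\mathrm{tr},\mathbf{N}}$. In particular, if $\deg f<d$ then $s(f,\mathbf{g})=f_{\mathrm{tr},\mathbf{N}}$.
   Context: Notation. $\mathbb{N}=\{0,1,2,\dots\}$; for $\alpha\in\mathbb{N}^n$, $|\alpha|=\sum_i\alpha_i$, $\mathbf{x}^\alpha=\prod_i x_i^{\alpha_i}$ and $\mathbf{N}^\alpha=\prod_i N_i^{\alpha_i}$. Write $f=\sum_\alpha f_\alpha\mathbf{x}^\alpha$. The trivial bound. Let $\Delta'(f):=\{\alpha\in\mathbb{N}^n:|\alpha|>0 \text{ and } f_\alpha\mathbf{x}^\alpha\text{ is not a square in }\mathbb{R}[x_1,\dots,x_n]\}$ and $f_{\mathrm{tr},\mathbf{N}}:=f(\mathbf{0})-\sum_{\alpha\in\Delta'(f)}|f_\alpha|\cdot\mathbf{N}^\alpha$. Fix an even integer $d\ge2$. Let $\epsilon_i\in\mathbb{N}^n$ have $i$-th entry $d$ and all other entries $0$. For $h=\sum_\alpha h_\alpha\mathbf{x}^\alpha\in\mathbb{R}[x_1,\dots,x_n]$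 with $\deg(h)\le d$, write $h_{d,i}:=h_{\epsilon_i}$ (the coefficient of $x_i^d$), $h(0)$ for the constant term, and - $\Omega(h):=\{\alpha\in\mathbb{N}^n : |\alpha|\le d,\ h_\alpha\ne0\}\setminus\{0,\epsilon_1,\dots,\epsilon_n\}$; - $\Delta(h):=\{\alpha\in\Omega(h): h_\alpha\mathbf{x}^\alpha \text{ is not a square in }\mathbb{R}[x_1,\dots,x_n]\}$; - $\Delta(h)^{<d}:=\{\alpha\in\Delta(h):|\alpha|<d\}$ and $\Delta(h)^{=d}:=\{\alpha\in\Delta(h):|\alpha|=d\}$. For $\mathbf{z}_\alpha=(z_{\alpha,i})\in[0,\infty)^n$ with $z_{\alpha,i}=0$ iff $\alpha_i=0$, put $\left(\frac{\alpha}{\mathbf{z}_\alpha}\right)^\alpha:=\prod_{i=1}^n\frac{\alpha_i^{\alpha_i}}{(z_{\alpha,i})^{\alpha_i}}$ and $\left(\frac{\mathbf{z}_\alpha}{\alpha}\right)^\alpha:=\prod_{i=1}^n\frac{(z_{\alpha,i})^{\alpha_i}}{\alpha_i^{\alpha_i}}$, with the convention $0^0=1$. The bound $h_{\mathrm{gp}}$. For $h$ with $\deg(h)\le d$, let $\rho(h)$ be the optimal value (infimum, equal to $+\infty$ if there is no feasible point) of: minimize $\sum_{\alpha\in\Delta(h)^{<d}}(d-|\alpha|)\left[\left(\frac{h_\alpha}{d}\right)^d\left(\frac{\alpha}{\mathbf{z}_\alpha}\right)^\alpha\right]^{1/(d-|\alpha|)}$ subject to $\sum_{\alpha\in\Delta(h)}z_{\alpha,i}\le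 h_{d,i}$ for $i=1,\dots,n$ and $\left(\frac{\mathbf{z}_\alpha}{\alpha}\right)^\alpha=\left(\frac{h_\alpha}{d}\right)^d$ for $\alpha\in\Delta(h)^{=d}$, over unknowns $\mathbf{z}_\alpha\in[0,\infty)^n$, $\alpha\in\Delta(h)$, with $z_{\alpha,i}=0$ iff $\alpha_i=0$. Set $h_{\mathrm{gp}}:=h(0)-\rho(h)\in\mathbb{R}\cup\{-\infty\}$. The bound $s(f,\mathbf{g})$. For $f$ and $\mathbf{g}=(g_1,\dots,g_m)$ all of degree at most $d$ and $\lambda\in[0,\infty)^m$ let $G(\lambda):=f-\sum_{j=1}^m\lambda_jg_j$, and define $s(f,\mathbf{g}):=\sup\{G(\lambda)_{\mathrm{gp}}:\lambda\in[0,\infty)^m\}$, where $G(\lambda)_{\mathrm{gp}}$ is formed with the fixed integer $d$. *)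

theory Defs
  imports Complex_Main "HOL-Library.Poly_Mapping" "HOL-Library.Extended_Real"
begin

text \<open>
  The polynomial ring \<open>\<real>[x\<^sub>1, \<dots>, x\<^sub>n]\<close> is the monoid algebra of the exponent vectors
  \<open>'n \<Rightarrow>\<^sub>0 nat\<close> over the reals, where the \<open>n\<close> variables are indexed by a finite type \<open>'n\<close>
  (\<open>n = CARD('n)\<close>). The product on \<open>\<Rightarrow>\<^sub>0\<close> is convolution, that is, polynomial multiplication.
\<close>

type_synonym 'n expo = "'n \<Rightarrow>\<^sub>0 nat"
type_synonym 'n rpoly = "'n expo \<Rightarrow>\<^sub>0 real"

abbreviation coef :: "'n rpoly \<Rightarrow> 'n expo \<Rightarrow> real"
  where "coef \<equiv> Poly_Mapping.lookup"

definition expo_size :: "('n::finite) expo \<Rightarrow> nat"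
  where "expo_size \<alpha> = (\<Sum>i\<in>UNIV. Poly_Mapping.lookup \<alpha> i)"

definition total_degree :: "('n::finite) rpoly \<Rightarrow> nat"  \<comment> \<open>the zero polynomial gets degree 0\<close>
  where "total_degree f = Max (insert 0 (expo_size ` Poly_Mapping.keys f))"

definition Const :: "real \<Rightarrow> 'n rpoly"
  where "Const c = Poly_Mapping.single 0 c"

definition Var :: "'n \<Rightarrow> 'n rpoly"
  where "Var i = Poly_Mapping.single (Poly_Mapping.single i 1) 1"

definition term_of_poly :: "'n rpoly \<Rightarrow> 'n expo \<Rightarrow> 'n rpoly"  \<comment> \<open>\<open>f\<^sub>\<alpha> x\<^sup>\<alpha>\<close>\<close>
  where "term_of_poly f \<alpha> = Poly_Mapping.single \<alpha> (coef f \<alpha>)"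

definition is_square_poly :: "'n rpoly \<Rightarrow> bool"
  where "is_square_poly p \<longleftrightarrow> (\<exists>q :: 'n rpoly. p = q ^ 2)"

text \<open>A vanishing term is a square, so \<open>Delta' f\<close> lies in the finite support of \<open>f\<close>.\<close>

definition Delta' :: "('n::finite) rpoly \<Rightarrow> 'n expo set"
  where "Delta' f = {\<alpha>. expo_size \<alpha> > 0 \<and> \<not> is_square_poly (term_of_poly f \<alpha>)}"

definition f_tr :: "('n::finite) rpoly \<Rightarrow> ('n \<Rightarrow> real) \<Rightarrow> real"
  where "f_tr f N =
    coef f 0 - (\<Sum>\<alpha>\<in>Delta' f. \<bar>coef f \<alpha>\<bar> * (\<Prod>i\<in>UNIV. N i ^ Poly_Mapping.lookup \<alpha> i))"

definition eps :: "nat \<Rightarrow> 'n \<Rightarrow> 'n expo"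
  where "eps d i = Poly_Mapping.single i d"

definition Omega :: "nat \<Rightarrow> ('n::finite) rpoly \<Rightarrow> 'n expo set"
  where "Omega d h = {\<alpha>. expo_size \<alpha> \<le> d \<and> coef h \<alpha> \<noteq> 0} - ({0} \<union> range (eps d))"

definition Delta :: "nat \<Rightarrow> ('n::finite) rpoly \<Rightarrow> 'n expo set"
  where "Delta d h = {\<alpha> \<in> Omega d h. \<not> is_square_poly (term_of_poly h \<alpha>)}"

definition Delta_less :: "nat \<Rightarrow> ('n::finite) rpoly \<Rightarrow> 'n expo set"
  where "Delta_less d h = {\<alpha> \<in> Delta d h. expo_size \<alpha> < d}"

definition Delta_eq :: "nat \<Rightarrow> ('n::finite) rpoly \<Rightarrow> 'n expo set"
  where "Delta_eq d h = {\<alpha> \<in> Delta d h. expo_size \<alpha> = d}"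

text \<open>The convention \<open>0\<^sup>0 = 1\<close> is that of HOL, so indices with \<open>\<alpha>\<^sub>i = 0\<close> contribute the factor 1.\<close>

definition expo_over :: "('n::finite) expo \<Rightarrow> ('n \<Rightarrow> real) \<Rightarrow> real"  \<comment> \<open>\<open>(\<alpha>/z)\<^sup>\<alpha>\<close>\<close>
  where "expo_over \<alpha> z =
    (\<Prod>i\<in>UNIV. real (Poly_Mapping.lookup \<alpha> i) ^ Poly_Mapping.lookup \<alpha> i
              / z i ^ Poly_Mapping.lookup \<alpha> i)"

definition over_expo :: "('n::finite) expo \<Rightarrow> ('n \<Rightarrow> real) \<Rightarrow> real"  \<comment> \<open>\<open>(z/\<alpha>)\<^sup>\<alpha>\<close>\<close>
  where "over_expo \<alpha> z =
    (\<Prod>i\<in>UNIV. z i ^ Poly_Mapping.lookup \<alpha> i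
              / real (Poly_Mapping.lookup \<alpha> i) ^ Poly_Mapping.lookup \<alpha> i)"

text \<open>
  A family \<open>(z\<^sub>\<alpha>)\<close> is a total function of \<open>\<alpha>\<close>; its values outside \<open>Delta d h\<close> are
  unconstrained and enter neither the constraints nor the objective.
\<close>

definition gp_feasible :: "nat \<Rightarrow> ('n::finite) rpoly \<Rightarrow> ('n expo \<Rightarrow> 'n \<Rightarrow> real) set"
  where "gp_feasible d h = {z.
    (\<forall>\<alpha>\<in>Delta d h. \<forall>i. 0 \<le> z \<alpha> i \<and> (z \<alpha> i = 0 \<longleftrightarrow> Poly_Mapping.lookup \<alpha> i = 0)) \<and>
    (\<forall>i. (\<Sum>\<alpha>\<in>Delta d h. z \<alpha> i) \<le> coef h (eps d i)) \<and>
    (\<forall>\<alpha>\<in>Delta_eq d h. over_expo \<alpha> (z \<alpha>) = (coef h \<alpha> / real d) ^ d)}"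

text \<open>
  For even \<open>d > 0\<close> and feasible \<open>z\<close> the base of \<open>powr\<close> is positive, so \<open>powr\<close> is the
  ordinary root.
\<close>

definition gp_objective :: "nat \<Rightarrow> ('n::finite) rpoly \<Rightarrow> ('n expo \<Rightarrow> 'n \<Rightarrow> real) \<Rightarrow> real"
  where "gp_objective d h z = (\<Sum>\<alpha>\<in>Delta_less d h.
    (real d - real (expo_size \<alpha>)) *
    ((coef h \<alpha> / real d) ^ d * expo_over \<alpha> (z \<alpha>)) powr (1 / (real d - real (expo_size \<alpha>))))"

definition gp_rho :: "nat \<Rightarrow> ('n::finite) rpoly \<Rightarrow> ereal"  \<comment> \<open>\<open>\<infinity>\<close> if there is no feasible point\<close>
  where "gp_rho d h = (INF z\<in>gp_feasible d h. ereal (gp_objective d h z))"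

definition h_gp :: "nat \<Rightarrow> ('n::finite) rpoly \<Rightarrow> ereal"
  where "h_gp d h = ereal (coef h 0) - gp_rho d h"

definition G_lam :: "('n::finite) rpoly \<Rightarrow> ('m::finite \<Rightarrow> 'n rpoly) \<Rightarrow> ('m \<Rightarrow> real) \<Rightarrow> 'n rpoly"
  where "G_lam f g l = f - (\<Sum>j\<in>UNIV. Const (l j) * g j)"

definition s_bound :: "nat \<Rightarrow> ('n::finite) rpoly \<Rightarrow> ('m::finite \<Rightarrow> 'n rpoly) \<Rightarrow> ereal"
  where "s_bound d f g = (SUP l\<in>{l. \<forall>j. 0 \<le> l j}. h_gp d (G_lam f g l))"

definition box_constraints :: "nat \<Rightarrow> ('n \<Rightarrow> real) \<Rightarrow> 'n \<Rightarrow> 'n rpoly"  \<comment> \<open>\<open>1 - (x\<^sub>i / N\<^sub>i)\<^sup>d\<close>\<close>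
  where "box_constraints d N i = 1 - (Const (1 / N i) * Var i) ^ d"

end

theory Submission imports Defs begin

text \<open>
  Passing from \<open>f\<close> to \<open>G(\<lambda>) = f - \<Sum>\<^sub>j \<lambda>\<^sub>j (1 - (x\<^sub>j / N\<^sub>j)\<^sup>d)\<close> changes only the constant term, which
  drops by \<open>\<Sum>\<^sub>j \<lambda>\<^sub>j\<close>, and the coefficients of \<open>x\<^sub>i\<^sup>d\<close>, which grow by \<open>\<lambda>\<^sub>i / N\<^sub>i\<^sup>d\<close>. The set \<open>\<Delta>\<close> and the
  objective of the geometric program are those of \<open>f\<close>, so that \<open>s(f, g)\<close> is the supremum of
  \<open>f(0) - \<Sum>\<^sub>i \<lambda>\<^sub>i - objective(z)\<close> over all \<open>\<lambda> \<ge> 0\<close> and all feasible \<open>z\<close>, where feasibility asks for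
  \<open>\<lambda>\<^sub>i \<ge> N\<^sub>i\<^sup>d (\<Sum>\<^sub>\<alpha> z\<^sub>\<alpha>\<^sub>,\<^sub>i - f\<^sub>d\<^sub>,\<^sub>i)\<close>. On the other side, the trivial bound charges \<open>|f\<^sub>\<alpha>| N\<^sup>\<alpha>\<close> for every
  \<open>\<alpha> \<in> \<Delta>\<close> and \<open>max(0, -f\<^sub>d\<^sub>,\<^sub>i) N\<^sub>i\<^sup>d\<close> for every \<open>i\<close> (lemma \<open>f_tr_eq\<close>).

  The two charges are compared for each \<open>\<alpha>\<close> separately. If \<open>B\<^sub>\<alpha>\<close> is the root in the objective, then
  the weighted inequality of arithmetic and geometric means, with weights \<open>\<alpha>\<^sub>i / d\<close> and
  \<open>(d - |\<alpha>|) / d\<close>, gives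
  \<open>|f\<^sub>\<alpha>| N\<^sup>\<alpha> \<le> \<Sum>\<^sub>i N\<^sub>i\<^sup>d z\<^sub>\<alpha>\<^sub>,\<^sub>i + (d - |\<alpha>|) B\<^sub>\<alpha>\<close> (lemma \<open>monomial_le_sum\<close>). If all \<open>f\<^sub>d\<^sub>,\<^sub>i \<le> 0\<close>, summing
  over \<open>\<alpha>\<close> and using the constraint on \<open>\<lambda>\<^sub>i\<close> bounds every value of the program by the trivial bound
  (lemma \<open>gp_value_le_f_tr\<close>). Without the sign condition this can fail, because a positive \<open>f\<^sub>d\<^sub>,\<^sub>i\<close> can
  pay for part of \<open>z\<close> while the trivial bound ignores it.

  Equality in the means holds when the averaged numbers agree, that is for
  \<open>z\<^sub>\<alpha>\<^sub>,\<^sub>i = \<alpha>\<^sub>i t\<^sub>\<alpha> / N\<^sub>i\<^sup>d\<close> with \<open>t\<^sub>\<alpha> = B\<^sub>\<alpha> = |f\<^sub>\<alpha>| N\<^sup>\<alpha> / d\<close>. This \<open>z\<close>, with a suitable \<open>\<lambda>\<close>, attains the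
  trivial bound whatever the signs of the \<open>f\<^sub>d\<^sub>,\<^sub>i\<close> (lemma \<open>gp_value_attains_f_tr\<close>).
\<close>

section \<open>Squares of monomials\<close>

text \<open>
  The sum of the coefficients is the value at the point \<open>(1, \<dots>, 1)\<close>. Being a ring homomorphism to
  the reals, it sends squares to nonnegative numbers, which is all that is needed to see that a
  monomial with a negative coefficient is not a square.
\<close>

definition coef_sum :: "('a \<Rightarrow>\<^sub>0 real) \<Rightarrow> real"
  where "coef_sum p = (\<Sum>k\<in>Poly_Mapping.keys p. Poly_Mapping.lookup p k)"

lemma coef_sum_add: "coef_sum (p + q) = coef_sum p + coef_sum q"
  unfolding coef_sum_def by (rule setsum_keys_plus_distrib) auto

lemma coef_sum_zero [simp]: "coef_sum 0 = 0"
  by (simp add: coef_sum_def)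

lemma coef_sum_single [simp]: "coef_sum (Poly_Mapping.single k c) = c"
  by (simp add: coef_sum_def)

lemma coef_sum_sum: "coef_sum (\<Sum>x\<in>A. p x) = (\<Sum>x\<in>A. coef_sum (p x))"
  by (induction A rule: infinite_finite_induct) (auto simp: coef_sum_add)

lemma sum_of_monomials:
  fixes p :: "'a \<Rightarrow>\<^sub>0 real"
  shows "(\<Sum>k\<in>Poly_Mapping.keys p. Poly_Mapping.single k (Poly_Mapping.lookup p k)) = p"
  by (rule poly_mapping_eqI) (auto simp: lookup_sum lookup_single when_def in_keys_iff)

lemma coef_sum_mult:
  fixes p q :: "('a::monoid_add) \<Rightarrow>\<^sub>0 real"
  shows "coef_sum (p * q) = coef_sum p * coef_sum q"
proof -
  let ?m = "\<lambda>p k. Poly_Mapping.single k (Poly_Mapping.lookup p k)"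
  have "p * q = (\<Sum>k\<in>Poly_Mapping.keys p. ?m p k) * (\<Sum>l\<in>Poly_Mapping.keys q. ?m q l)"
    by (simp add: sum_of_monomials)
  also have "\<dots> = (\<Sum>k\<in>Poly_Mapping.keys p. \<Sum>l\<in>Poly_Mapping.keys q.
      Poly_Mapping.single (k + l) (Poly_Mapping.lookup p k * Poly_Mapping.lookup q l))"
    by (simp add: sum_product mult_single)
  finally have "coef_sum (p * q) = (\<Sum>k\<in>Poly_Mapping.keys p. \<Sum>l\<in>Poly_Mapping.keys q.
      Poly_Mapping.lookup p k * Poly_Mapping.lookup q l)"
    by (simp add: coef_sum_sum)
  then show ?thesis by (simp add: coef_sum_def sum_product)
qed

lemma square_monomial_imp_nonneg:
  assumes "is_square_poly (Poly_Mapping.single \<alpha> c)"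
  shows "0 \<le> c"
proof -
  obtain q where "Poly_Mapping.single \<alpha> c = q ^ 2"
    using assms by (auto simp: is_square_poly_def)
  then have "c = coef_sum (q ^ 2)" by (metis coef_sum_single)
  then show ?thesis by (simp add: power2_eq_square coef_sum_mult)
qed

lemma square_monomial_eps:
  assumes "even d"
  shows "is_square_poly (Poly_Mapping.single (eps d i) c) \<longleftrightarrow> 0 \<le> c"
proof
  assume "0 \<le> c"
  obtain k where d: "d = k + k" using assms by (metis evenE mult_2)
  have "Poly_Mapping.single (eps d i) c = (Poly_Mapping.single (eps k i) (sqrt c)) ^ 2"
    using \<open>0 \<le> c\<close> by (simp add: power2_eq_square mult_single eps_def d single_add)
  then show "is_square_poly (Poly_Mapping.single (eps d i) c)"
    by (auto simp: is_square_poly_def)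
qed (rule square_monomial_imp_nonneg)

section \<open>The trivial bound\<close>

lemma coef_eq_zero_of_total_degree:
  assumes "total_degree f < expo_size \<alpha>"
  shows "coef f \<alpha> = 0"
proof (rule ccontr)
  assume "coef f \<alpha> \<noteq> 0"
  then have "expo_size \<alpha> \<le> total_degree f"
    unfolding total_degree_def by (intro Max_ge) (auto simp: in_keys_iff)
  with assms show False by simp
qed

lemma expo_size_eps [simp]: "expo_size (eps d i) = d"
  by (simp add: expo_size_def eps_def lookup_single when_def)

lemma finite_Delta [simp]: "finite (Delta d h)"
  by (rule finite_subset[of _ "Poly_Mapping.keys h"]) (auto simp: Delta_def Omega_def in_keys_iff)

lemma expo_size_pos_iff: "0 < expo_size \<alpha> \<longleftrightarrow> \<alpha> \<noteq> 0"
proof -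
  have "expo_size \<alpha> = 0 \<longleftrightarrow> \<alpha> = 0"
    by (auto simp: expo_size_def intro!: poly_mapping_eqI)
  then show ?thesis by (simp only: neq0_conv[symmetric])
qed

lemma eps_neq_0: "0 < d \<Longrightarrow> eps d (i::'n::finite) \<noteq> 0"
  using expo_size_pos_iff[of "eps d i"] by simp

text \<open>
  As \<open>d\<close> is even, a term \<open>c x\<^sub>i\<^sup>d\<close> fails to be a square exactly when \<open>c < 0\<close>. The degree bound on \<open>f\<close>
  ensures that the cut-off \<open>|\<alpha>| \<le> d\<close> in \<open>\<Omega>\<close> loses no term.
\<close>

lemma Delta'_eq:
  assumes "even d" "0 < d" "total_degree f \<le> d"
  shows "Delta' f = Delta d f \<union> eps d ` {i. coef f (eps d i) < 0}"
proof -
  have "coef f \<alpha> \<noteq> 0 \<and> expo_size \<alpha> \<le> d" if "\<not> is_square_poly (term_of_poly f \<alpha>)" for \<alpha>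
  proof -
    have "is_square_poly (0 :: 'a rpoly)" by (auto simp: is_square_poly_def intro: exI[of _ 0])
    then have "coef f \<alpha> \<noteq> 0" using that by (auto simp: term_of_poly_def)
    then show ?thesis
      using coef_eq_zero_of_total_degree[of f \<alpha>] assms(3) by force
  qed
  moreover have "is_square_poly (term_of_poly f (eps d i)) \<longleftrightarrow> 0 \<le> coef f (eps d i)" for i
    by (simp add: term_of_poly_def square_monomial_eps assms)
  moreover have "eps d i \<noteq> 0" for i :: 'a
    using eps_neq_0 assms by blast
  ultimately show ?thesis
    by (auto simp: Delta'_def Delta_def Omega_def expo_size_pos_iff not_le)
qed

lemma inj_eps: "0 < d \<Longrightarrow> inj (eps d)"
proof (rule injI)
  fix i j :: 'a
  assume "0 < d" "eps d i = eps d j"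
  then have "Poly_Mapping.keys (eps d i) = Poly_Mapping.keys (eps d j)" by simp
  with \<open>0 < d\<close> show "i = j" by (simp add: eps_def)
qed

abbreviation monom_at :: "('n::finite \<Rightarrow> real) \<Rightarrow> 'n expo \<Rightarrow> real"
  where "monom_at N \<alpha> \<equiv> (\<Prod>i\<in>UNIV. N i ^ Poly_Mapping.lookup \<alpha> i)"

lemma monom_at_eps [simp]: "monom_at N (eps d i) = N i ^ d"
proof -
  have "monom_at N (eps d i) = (\<Prod>j\<in>UNIV. if i = j then N j ^ d else 1)"
    by (intro prod.cong) (auto simp: eps_def lookup_single when_def)
  then show ?thesis by simp
qed

lemma f_tr_eq:
  assumes "even d" "0 < d" "total_degree f \<le> d"
  shows "f_tr f N = coef f 0 - (\<Sum>\<alpha>\<in>Delta d f. \<bar>coef f \<alpha>\<bar> * monom_at N \<alpha>)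
    - (\<Sum>i\<in>UNIV. max 0 (- coef f (eps d i)) * N i ^ d)"
proof -
  let ?P = "{i. coef f (eps d i) < 0}"
  let ?t = "\<lambda>\<alpha>. \<bar>coef f \<alpha>\<bar> * monom_at N \<alpha>"
  have "sum ?t (Delta' f) = sum ?t (Delta d f) + sum ?t (eps d ` ?P)"
    unfolding Delta'_eq[OF assms]
    by (rule sum.union_disjoint) (auto simp: Delta_def Omega_def)
  also have "sum ?t (eps d ` ?P) = (\<Sum>i\<in>?P. \<bar>coef f (eps d i)\<bar> * N i ^ d)"
    using inj_eps[OF assms(2)] by (subst sum.reindex) (auto intro: inj_on_subset)
  also have "\<dots> = (\<Sum>i\<in>UNIV. max 0 (- coef f (eps d i)) * N i ^ d)"
    by (rule sum.mono_neutral_cong_left) auto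
  finally show ?thesis by (simp add: f_tr_def)
qed

section \<open>The polynomial \<open>G(\<lambda>)\<close> for box constraints\<close>

lemma box_constraints_eq:
  "box_constraints d N i = 1 - Poly_Mapping.single (eps d i) (1 / N i ^ d)"
proof -
  have "(Const a * Var i) ^ k = Poly_Mapping.single (eps k i) (a ^ k)" for a k
    by (induction k)
      (auto simp: Const_def Var_def eps_def mult_single single_add[symmetric])
  then show ?thesis by (simp add: box_constraints_def power_divide)
qed

lemma coef_G_lam:
  "coef (G_lam f (box_constraints d N) l) \<alpha> =
    coef f \<alpha> - (\<Sum>j\<in>UNIV. l j * ((1 when \<alpha> = 0) - (1 / N j ^ d when \<alpha> = eps d j)))"
proof -
  have "coef (Const a * (1 - Poly_Mapping.single \<beta> b)) \<alpha>
      = a * ((1 when \<alpha> = 0) - (b when \<alpha> = \<beta>))" for a b and \<beta> :: "'a expo"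
    by (simp add: Const_def right_diff_distrib mult_single lookup_minus lookup_single when_def)
  then show ?thesis
    by (simp add: G_lam_def lookup_minus lookup_sum box_constraints_eq)
qed

lemma coef_G_lam_0:
  "0 < d \<Longrightarrow> coef (G_lam f (box_constraints d N) l) 0 = coef f 0 - (\<Sum>j\<in>UNIV. l j)"
  by (simp add: coef_G_lam when_def eps_neq_0 eps_neq_0[symmetric])

lemma coef_G_lam_eps:
  assumes "0 < d"
  shows "coef (G_lam f (box_constraints d N) l) (eps d i) = coef f (eps d i) + l i / N i ^ d"
proof -
  have "eps d i = eps d j \<longleftrightarrow> j = i" for j
    using inj_eps[OF assms] by (auto dest: injD)
  moreover have "(\<Sum>j\<in>UNIV. l j * (0 - (1 / N j ^ d when j = i))) = - (l i / N i ^ d)"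
    by (simp add: when_def if_distrib cong: if_cong)
  ultimately show ?thesis using assms by (simp add: coef_G_lam eps_neq_0)
qed

text \<open>
  Off the constant term and the pure powers \<open>x\<^sub>i\<^sup>d\<close> nothing changes, so the data of the geometric
  program of \<open>G(\<lambda>)\<close> are those of \<open>f\<close> except for the right-hand sides of its linear constraints.
\<close>

lemma coef_G_lam_other:
  assumes "\<alpha> \<notin> {0} \<union> range (eps d)"
  shows "coef (G_lam f (box_constraints d N) l) \<alpha> = coef f \<alpha>"
  using assms by (auto simp: coef_G_lam when_def intro!: sum.neutral)

lemma Delta_G_lam: "Delta d (G_lam f (box_constraints d N) l) = Delta d f"
  by (auto simp: Delta_def Omega_def term_of_poly_def coef_G_lam_other)

lemma coef_G_lam_Delta:
  "\<alpha> \<in> Delta d f \<Longrightarrow> coef (G_lam f (box_constraints d N) l) \<alpha> = coef f \<alpha>"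
  by (rule coef_G_lam_other) (simp add: Delta_def Omega_def)

section \<open>Arithmetic and geometric means\<close>

text \<open>
  If the weighted mean \<open>S\<close> is positive, \<open>x\<^sub>i / S \<le> exp (x\<^sub>i / S - 1)\<close> for every \<open>i\<close>; in the product of the powers
  the exponents on the right add up to \<open>0\<close>. Powers with natural exponents replace the usual real
  weights, so that vanishing \<open>x\<^sub>i\<close> and vanishing weights are covered with \<open>0\<^sup>0 = 1\<close>.
\<close>

lemma weighted_am_gm:
  fixes x :: "'a \<Rightarrow> real" and k :: "'a \<Rightarrow> nat"
  assumes "finite A" and x: "\<And>i. i \<in> A \<Longrightarrow> 0 \<le> x i" and d: "(\<Sum>i\<in>A. k i) = d" "0 < d"
  shows "(\<Prod>i\<in>A. x i ^ k i) \<le> ((\<Sum>i\<in>A. real (k i) * x i) / real d) ^ d"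
proof -
  define S where "S = (\<Sum>i\<in>A. real (k i) * x i) / real d"
  have "0 \<le> S" unfolding S_def using x by (intro divide_nonneg_nonneg sum_nonneg) auto
  show ?thesis
  proof (cases "S = 0")
    case True
    then have "(\<Sum>i\<in>A. real (k i) * x i) = 0" using d by (simp add: S_def)
    then have all0: "\<forall>i\<in>A. real (k i) * x i = 0"
      using assms by (subst (asm) sum_nonneg_eq_0_iff) auto
    have "\<exists>i\<in>A. 0 < k i" using d by (intro ccontr[of "\<exists>i\<in>A. 0 < k i"]) auto
    then obtain i where "i \<in> A" "0 < k i" by blast
    then have "(\<Prod>i\<in>A. x i ^ k i) = 0" using all0 \<open>finite A\<close> by (auto intro!: prod_zero)
    then show ?thesis using \<open>0 \<le> S\<close> by (simp add: S_def)
  next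
    case False
    with \<open>0 \<le> S\<close> have "0 < S" by simp
    have "(\<Prod>i\<in>A. x i ^ k i) \<le> (\<Prod>i\<in>A. (S * exp (x i / S - 1)) ^ k i)"
    proof (intro prod_mono conjI power_mono)
      fix i assume "i \<in> A"
      show "x i \<le> S * exp (x i / S - 1)"
        using exp_ge_add_one_self[of "x i / S - 1"] \<open>0 < S\<close> by (simp add: field_simps)
    qed (use x in auto)
    also have "\<dots> = S ^ d * exp (\<Sum>i\<in>A. real (k i) * (x i / S - 1))"
      unfolding d(1)[symmetric] power_sum using \<open>finite A\<close>
      by (simp add: power_mult_distrib prod.distrib exp_sum exp_of_nat_mult)
    also have "(\<Sum>i\<in>A. real (k i) * (x i / S - 1)) = (\<Sum>i\<in>A. real (k i) * x i) / S - real d"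
      using d by (simp add: right_diff_distrib sum_subtractf sum_divide_distrib flip: of_nat_sum)
    also have "\<dots> = 0" using d \<open>0 < S\<close> by (simp add: S_def field_simps)
    finally show ?thesis by (simp add: S_def)
  qed
qed

section \<open>One monomial of the geometric program\<close>

text \<open>
  The root in the objective, as a function of a single exponent. For \<open>|\<alpha>| = d\<close> its exponent is
  \<open>1 / 0 = 0\<close>, but then it only occurs with the factor \<open>d - |\<alpha>| = 0\<close>; this allows the objective to be
  written as a sum over all of \<open>\<Delta>\<close>.
\<close>

definition gp_root :: "nat \<Rightarrow> real \<Rightarrow> ('n::finite) expo \<Rightarrow> ('n \<Rightarrow> real) \<Rightarrow> real"
  where "gp_root d c \<alpha> z =
    ((c / real d) ^ d * expo_over \<alpha> z) powr (1 / (real d - real (expo_size \<alpha>)))"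

lemma gp_objective_eq:
  "gp_objective d h z =
    (\<Sum>\<alpha>\<in>Delta d h. (real d - real (expo_size \<alpha>)) * gp_root d (coef h \<alpha>) \<alpha> (z \<alpha>))"
  unfolding gp_objective_def gp_root_def Delta_less_def
  by (rule sum.mono_neutral_left) (auto simp: Delta_def Omega_def)

lemma expo_over_eq_inverse: "expo_over \<alpha> z = inverse (over_expo \<alpha> z)"
  by (simp add: expo_over_def over_expo_def prod_dividef)

lemma over_expo_pos:
  assumes "\<And>i. 0 \<le> z i \<and> (z i = 0 \<longleftrightarrow> Poly_Mapping.lookup \<alpha> i = 0)"
  shows "0 < over_expo \<alpha> z"
  unfolding over_expo_def
proof (rule prod_pos)
  fix i
  have "0 < z i \<or> Poly_Mapping.lookup \<alpha> i = 0" using assms[of i] by linarith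
  then show "0 < z i ^ Poly_Mapping.lookup \<alpha> i
      / real (Poly_Mapping.lookup \<alpha> i) ^ Poly_Mapping.lookup \<alpha> i"
    by (cases "Poly_Mapping.lookup \<alpha> i = 0") auto
qed

lemma powr_inverse_power:
  fixes a :: real
  assumes "0 < a" "0 < k"
  shows "(a powr (1 / real k)) ^ k = a"
  using assms by (simp add: powr_powr flip: powr_realpow)

text \<open>
  Together with the equality constraint of the program for \<open>|\<alpha>| = d\<close>, this says that
  \<open>B\<^bsup>d - |\<alpha>|\<^esup> (z/\<alpha>)\<^sup>\<alpha> = (f\<^sub>\<alpha> / d)\<^sup>d\<close> for every \<open>\<alpha> \<in> \<Delta>\<close>: the two kinds of exponents obey the same law.
\<close>

lemma gp_root_power:
  assumes "expo_size \<alpha> < d" "even d" "c \<noteq> 0" "0 < over_expo \<alpha> z"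
  shows "gp_root d c \<alpha> z ^ (d - expo_size \<alpha>) * over_expo \<alpha> z = (c / real d) ^ d"
proof -
  have "0 < (c / real d) ^ d" using assms by (simp add: zero_less_power_eq)
  then have "gp_root d c \<alpha> z ^ (d - expo_size \<alpha>) = (c / real d) ^ d * expo_over \<alpha> z"
    using assms powr_inverse_power[of _ "d - expo_size \<alpha>"]
    by (simp add: gp_root_def expo_over_eq_inverse of_nat_diff)
  then show ?thesis using assms by (simp add: expo_over_eq_inverse)
qed

text \<open>
  This is the inequality of means for the numbers \<open>d N\<^sub>i\<^sup>d z\<^sub>i / \<alpha>\<^sub>i\<close>, taken \<open>\<alpha>\<^sub>i\<close> times, and \<open>d B\<close>, taken
  \<open>d - |\<alpha>|\<close> times: their product is the \<open>d\<close>-th power of the left-hand side, and their sum is \<open>d\<close>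
  times the right-hand side.
\<close>

lemma monomial_le_sum:
  assumes N: "\<And>i. 0 < N i" and d: "0 < d" "even d" "expo_size \<alpha> \<le> d"
    and z: "\<And>i. 0 \<le> z i \<and> (z i = 0 \<longleftrightarrow> Poly_Mapping.lookup \<alpha> i = 0)"
    and B: "0 \<le> B" "B ^ (d - expo_size \<alpha>) * over_expo \<alpha> z = (c / real d) ^ d"
  shows "\<bar>c\<bar> * monom_at N \<alpha> \<le> (\<Sum>i\<in>UNIV. N i ^ d * z i) + (real d - real (expo_size \<alpha>)) * B"
proof -
  let ?a = "Poly_Mapping.lookup \<alpha>"
  \<comment> \<open>The index \<open>None\<close> carries the extra number \<open>d B\<close>. Where \<open>\<alpha>\<^sub>i = 0\<close>, division by zero gives \<open>x = 0\<close>,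
    with multiplicity \<open>0\<close>.\<close>
  define x where "x = case_option (real d * B) (\<lambda>i. real d * N i ^ d * z i / real (?a i))"
  define k where "k = case_option (d - expo_size \<alpha>) ?a"
  let ?Y = "(\<Sum>i\<in>UNIV. N i ^ d * z i) + (real d - real (expo_size \<alpha>)) * B"
  have "(\<Prod>j\<in>UNIV. x j ^ k j) \<le> ((\<Sum>j\<in>UNIV. real (k j) * x j) / real d) ^ d"
  proof (rule weighted_am_gm)
    show "0 \<le> x j" for j
      using N z B by (auto simp: x_def less_imp_le split: option.split)
    show "(\<Sum>j\<in>UNIV. k j) = d"
      using d by (simp add: UNIV_option_conv sum.reindex k_def expo_size_def)
  qed (use d in auto)
  also have "(\<Sum>j\<in>UNIV. real (k j) * x j) = real d * ?Y"
  proof -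
    have "real (?a i) * (real d * N i ^ d * z i / real (?a i)) = real d * (N i ^ d * z i)" for i
      using z[of i] by (cases "?a i = 0") auto
    then show ?thesis using d
      by (simp add: UNIV_option_conv sum.reindex k_def x_def of_nat_diff algebra_simps sum_distrib_left)
  qed
  also have "(\<Prod>j\<in>UNIV. x j ^ k j) = (\<bar>c\<bar> * monom_at N \<alpha>) ^ d"
  proof -
    have "(real d * N i ^ d * z i / real (?a i)) ^ ?a i
        = real d ^ ?a i * (N i ^ ?a i) ^ d * (z i ^ ?a i / real (?a i) ^ ?a i)" for i
      by (simp add: power_mult_distrib power_divide mult.commute flip: power_mult)
    then have "(\<Prod>i\<in>UNIV. (real d * N i ^ d * z i / real (?a i)) ^ ?a i)
        = real d ^ expo_size \<alpha> * monom_at N \<alpha> ^ d * over_expo \<alpha> z"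
      by (simp only: prod.distrib over_expo_def expo_size_def power_sum prod_power_distrib)
    then have "(\<Prod>j\<in>UNIV. x j ^ k j) = (real d * B) ^ (d - expo_size \<alpha>) *
        (real d ^ expo_size \<alpha> * monom_at N \<alpha> ^ d * over_expo \<alpha> z)"
      by (simp add: UNIV_option_conv prod.reindex x_def k_def)
    also have "\<dots> = (real d ^ (d - expo_size \<alpha>) * real d ^ expo_size \<alpha>) * monom_at N \<alpha> ^ d *
        (B ^ (d - expo_size \<alpha>) * over_expo \<alpha> z)"
      by (simp add: power_mult_distrib)
    also have "\<dots> = real d ^ d * monom_at N \<alpha> ^ d * (c / real d) ^ d"
      using d by (simp only: B flip: power_add) simp
    also have "\<dots> = (\<bar>c\<bar> * monom_at N \<alpha>) ^ d"
      using d by (simp add: power_divide power_mult_distrib power_even_abs)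
    finally show ?thesis .
  qed
  finally have "(\<bar>c\<bar> * monom_at N \<alpha>) ^ d \<le> ?Y ^ d" using d by simp
  moreover have "0 \<le> ?Y"
    using N z B d by (intro add_nonneg_nonneg sum_nonneg mult_nonneg_nonneg) (auto simp: less_imp_le)
  moreover have "0 \<le> \<bar>c\<bar> * monom_at N \<alpha>"
    using N by (intro mult_nonneg_nonneg prod_nonneg) (auto simp: less_imp_le)
  ultimately show ?thesis using d by (simp add: power_mono_iff)
qed

text \<open>
  At \<open>z\<^sub>i = \<alpha>\<^sub>i t / N\<^sub>i\<^sup>d\<close> all the numbers \<open>d N\<^sub>i\<^sup>d z\<^sub>i / \<alpha>\<^sub>i\<close> with \<open>\<alpha>\<^sub>i > 0\<close> are equal to \<open>d t\<close>.
\<close>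

lemma over_expo_balanced:
  "over_expo \<alpha> (\<lambda>i. real (Poly_Mapping.lookup \<alpha> i) * t / N i ^ d)
    = t ^ expo_size \<alpha> / monom_at N \<alpha> ^ d"
proof -
  let ?a = "Poly_Mapping.lookup \<alpha>"
  have "(real (?a i) * t / N i ^ d) ^ ?a i / real (?a i) ^ ?a i
      = t ^ ?a i / (N i ^ ?a i) ^ d" for i
    by (cases "?a i = 0") (auto simp: power_mult_distrib power_divide mult.commute simp flip: power_mult)
  then show ?thesis
    by (simp add: over_expo_def prod_dividef expo_size_def power_sum prod_power_distrib)
qed

text \<open>
  The value of \<open>t\<close> is the one for which \<open>d B\<close> agrees with these numbers as well, so that equality holds
  in the arithmetic-geometric mean inequality.
\<close>

lemma gp_root_balanced:
  assumes "expo_size \<alpha> < d" "even d" "0 < monom_at N \<alpha>" "c \<noteq> 0"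
    and t: "t = \<bar>c\<bar> * monom_at N \<alpha> / real d"
  shows "gp_root d c \<alpha> (\<lambda>i. real (Poly_Mapping.lookup \<alpha> i) * t / N i ^ d) = t"
proof -
  define m where "m = monom_at N \<alpha>"
  have "0 < m" and tm: "t / m = \<bar>c\<bar> / real d" using assms(3) by (simp_all add: t flip: m_def)
  then have "0 < t" using assms by (simp add: t flip: m_def)
  have "(c / real d) ^ d = (t / m) ^ d"
    unfolding tm using assms(2) by (simp add: power_divide power_even_abs)
  then have "(c / real d) ^ d * expo_over \<alpha> (\<lambda>i. real (Poly_Mapping.lookup \<alpha> i) * t / N i ^ d)
      = t ^ d / t ^ expo_size \<alpha>"
    using \<open>0 < m\<close>
    by (simp add: expo_over_eq_inverse over_expo_balanced power_divide flip: m_def)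
  also have "\<dots> = t powr (real d - real (expo_size \<alpha>))"
    using \<open>0 < t\<close> by (simp add: powr_diff powr_realpow)
  finally show ?thesis
    using assms \<open>0 < t\<close> by (simp add: gp_root_def powr_powr)
qed

section \<open>Comparison of the two bounds\<close>

lemma gp_objective_G_lam:
  "gp_objective d (G_lam f (box_constraints d N) l) z = gp_objective d f z"
  unfolding gp_objective_eq Delta_G_lam by (intro sum.cong) (auto simp: coef_G_lam_Delta)

lemma gp_feasible_G_lam_iff:
  assumes "0 < d"
  shows "z \<in> gp_feasible d (G_lam f (box_constraints d N) l) \<longleftrightarrow>
    (\<forall>\<alpha>\<in>Delta d f. \<forall>i. 0 \<le> z \<alpha> i \<and> (z \<alpha> i = 0 \<longleftrightarrow> Poly_Mapping.lookup \<alpha> i = 0)) \<and>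
    (\<forall>i. (\<Sum>\<alpha>\<in>Delta d f. z \<alpha> i) \<le> coef f (eps d i) + l i / N i ^ d) \<and>
    (\<forall>\<alpha>\<in>Delta d f. expo_size \<alpha> = d \<longrightarrow> over_expo \<alpha> (z \<alpha>) = (coef f \<alpha> / real d) ^ d)"
  using assms
  by (auto simp: gp_feasible_def Delta_eq_def Delta_G_lam coef_G_lam_Delta coef_G_lam_eps)

text \<open>
  By the constraint, \<open>\<Sum>\<^sub>i \<lambda>\<^sub>i\<close> is at least \<open>\<Sum>\<^sub>i \<Sum>\<^sub>\<alpha> N\<^sub>i\<^sup>d z\<^sub>\<alpha>\<^sub>,\<^sub>i\<close> plus the charge of the trivial bound for the
  pure powers; this is where the sign of \<open>f\<^sub>d\<^sub>,\<^sub>i\<close> enters. The double sum and the objective together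
  dominate the remaining charges, one monomial at a time.
\<close>

lemma gp_value_le_f_tr:
  assumes N: "\<And>i. 0 < N i" and d: "0 < d" "even d" "total_degree f \<le> d"
    and neg: "\<And>i. coef f (eps d i) \<le> 0"
    and z: "z \<in> gp_feasible d (G_lam f (box_constraints d N) l)"
  shows "coef f 0 - (\<Sum>i\<in>UNIV. l i) - gp_objective d f z \<le> f_tr f N"
proof -
  let ?R = "\<lambda>\<alpha>. (real d - real (expo_size \<alpha>)) * gp_root d (coef f \<alpha>) \<alpha> (z \<alpha>)"
  note feas = z[unfolded gp_feasible_G_lam_iff[OF d(1)]]
  have mono: "\<bar>coef f \<alpha>\<bar> * monom_at N \<alpha> \<le> (\<Sum>i\<in>UNIV. N i ^ d * z \<alpha> i) + ?R \<alpha>"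
    if \<alpha>: "\<alpha> \<in> Delta d f" for \<alpha>
  proof -
    let ?B = "gp_root d (coef f \<alpha>) \<alpha> (z \<alpha>)"
    have le: "expo_size \<alpha> \<le> d" and c: "coef f \<alpha> \<noteq> 0" using \<alpha> by (auto simp: Delta_def Omega_def)
    have za: "0 \<le> z \<alpha> i \<and> (z \<alpha> i = 0 \<longleftrightarrow> Poly_Mapping.lookup \<alpha> i = 0)" for i
      using feas \<alpha> by blast
    have "?B ^ (d - expo_size \<alpha>) * over_expo \<alpha> (z \<alpha>) = (coef f \<alpha> / real d) ^ d"
    proof (cases "expo_size \<alpha> = d")
      case True
      then show ?thesis using feas \<alpha> by auto
    next
      case False
      then show ?thesis using gp_root_power[OF _ d(2) c over_expo_pos[OF za]] le by simp
    qed
    moreover have "0 \<le> ?B" by (simp add: gp_root_def)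
    ultimately show ?thesis using monomial_le_sum[where N = N, OF N d(1,2) le za] by blast
  qed
  have lam: "(\<Sum>\<alpha>\<in>Delta d f. N i ^ d * z \<alpha> i) + max 0 (- coef f (eps d i)) * N i ^ d \<le> l i" for i
  proof -
    have "(\<Sum>\<alpha>\<in>Delta d f. z \<alpha> i) - coef f (eps d i) \<le> l i / N i ^ d"
      using feas by (simp add: algebra_simps)
    then show ?thesis
      using N[of i] neg[of i] by (simp add: max_def field_simps sum_distrib_left)
  qed
  have "(\<Sum>\<alpha>\<in>Delta d f. \<bar>coef f \<alpha>\<bar> * monom_at N \<alpha>)
      \<le> (\<Sum>i\<in>UNIV. \<Sum>\<alpha>\<in>Delta d f. N i ^ d * z \<alpha> i) + gp_objective d f z"
    unfolding gp_objective_eq using sum_mono[OF mono]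
    by (subst sum.swap) (simp add: sum.distrib)
  moreover have "(\<Sum>i\<in>UNIV. \<Sum>\<alpha>\<in>Delta d f. N i ^ d * z \<alpha> i)
      + (\<Sum>i\<in>UNIV. max 0 (- coef f (eps d i)) * N i ^ d) \<le> (\<Sum>i\<in>UNIV. l i)"
    using sum_mono[where K = UNIV, OF lam] by (simp add: sum.distrib)
  ultimately show ?thesis by (simp add: f_tr_eq[OF d(2,1,3)])
qed

text \<open>
  All \<open>z\<^sub>\<alpha>\<close> are taken at the balanced point. The multiplier \<open>\<lambda>\<^sub>i\<close> pays \<open>N\<^sub>i\<^sup>d \<Sum>\<^sub>\<alpha> z\<^sub>\<alpha>\<^sub>,\<^sub>i = \<Sum>\<^sub>\<alpha> \<alpha>\<^sub>i t\<^sub>\<alpha>\<close> and compensates a negative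
  \<open>f\<^sub>d\<^sub>,\<^sub>i\<close>. The monomial \<open>\<alpha>\<close> then costs \<open>|\<alpha>| t\<^sub>\<alpha>\<close> through \<open>\<lambda>\<close> and \<open>(d - |\<alpha>|) t\<^sub>\<alpha>\<close> through the objective,
  together \<open>d t\<^sub>\<alpha> = |f\<^sub>\<alpha>| N\<^sup>\<alpha>\<close>.
\<close>

lemma gp_value_attains_f_tr:
  assumes N: "\<And>i. 0 < N i" and d: "0 < d" "even d" "total_degree f \<le> d"
  obtains l z where "\<forall>i. 0 \<le> l i"
    and "z \<in> gp_feasible d (G_lam f (box_constraints d N) l)"
    and "coef f 0 - (\<Sum>i\<in>UNIV. l i) - gp_objective d f z = f_tr f N"
proof -
  define t where "t \<alpha> = \<bar>coef f \<alpha>\<bar> * monom_at N \<alpha> / real d" for \<alpha>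
  define z where "z \<alpha> = (\<lambda>i. real (Poly_Mapping.lookup \<alpha> i) * t \<alpha> / N i ^ d)" for \<alpha>
  define l where "l i = (\<Sum>\<alpha>\<in>Delta d f. real (Poly_Mapping.lookup \<alpha> i) * t \<alpha>)
      + max 0 (- coef f (eps d i)) * N i ^ d" for i
  have m: "0 < monom_at N \<alpha>" for \<alpha> using N by (intro prod_pos) auto
  have N0: "N i \<noteq> 0" for i using N[of i] by simp
  have t0: "0 \<le> t \<alpha>" for \<alpha> using m[of \<alpha>] by (simp add: t_def)
  have \<alpha>: "expo_size \<alpha> \<le> d" "coef f \<alpha> \<noteq> 0" if "\<alpha> \<in> Delta d f" for \<alpha>
    using that by (auto simp: Delta_def Omega_def)
  have tpos: "0 < t \<alpha>" if "\<alpha> \<in> Delta d f" for \<alpha>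
    using m[of \<alpha>] \<alpha>[OF that] d by (simp add: t_def)
  have "\<forall>i. 0 \<le> l i"
    using t0 N[THEN less_imp_le] by (auto simp: l_def intro!: add_nonneg_nonneg sum_nonneg)
  moreover have "z \<in> gp_feasible d (G_lam f (box_constraints d N) l)"
    unfolding gp_feasible_G_lam_iff[OF d(1)]
  proof (intro conjI ballI allI impI)
    fix \<alpha> i assume "\<alpha> \<in> Delta d f"
    then show "0 \<le> z \<alpha> i" "z \<alpha> i = 0 \<longleftrightarrow> Poly_Mapping.lookup \<alpha> i = 0"
      using tpos[of \<alpha>] N[of i] by (auto simp: z_def)
  next
    fix i
    have "l i / N i ^ d = (\<Sum>\<alpha>\<in>Delta d f. z \<alpha> i) + max 0 (- coef f (eps d i))"
      using N0[of i] by (simp add: l_def z_def add_divide_distrib sum_divide_distrib)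
    then show "(\<Sum>\<alpha>\<in>Delta d f. z \<alpha> i) \<le> coef f (eps d i) + l i / N i ^ d" by simp
  next
    fix \<alpha> assume "\<alpha> \<in> Delta d f" "expo_size \<alpha> = d"
    then show "over_expo \<alpha> (z \<alpha>) = (coef f \<alpha> / real d) ^ d"
      using N0 d
      by (simp add: z_def over_expo_balanced) (simp add: t_def power_divide power_mult_distrib power_even_abs)
  qed
  moreover have "coef f 0 - (\<Sum>i\<in>UNIV. l i) - gp_objective d f z = f_tr f N"
  proof -
    have "gp_objective d f z = (\<Sum>\<alpha>\<in>Delta d f. (real d - real (expo_size \<alpha>)) * t \<alpha>)"
      unfolding gp_objective_eq
    proof (rule sum.cong)
      fix \<alpha> assume D: "\<alpha> \<in> Delta d f"
      show "(real d - real (expo_size \<alpha>)) * gp_root d (coef f \<alpha>) \<alpha> (z \<alpha>)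
          = (real d - real (expo_size \<alpha>)) * t \<alpha>"
        using gp_root_balanced[OF _ d(2) m \<alpha>(2)[OF D] t_def] \<alpha>(1)[OF D]
        by (cases "expo_size \<alpha> = d") (auto simp: z_def)
    qed simp
    moreover have "(\<Sum>i\<in>UNIV. l i) = (\<Sum>\<alpha>\<in>Delta d f. real (expo_size \<alpha>) * t \<alpha>)
        + (\<Sum>i\<in>UNIV. max 0 (- coef f (eps d i)) * N i ^ d)"
      unfolding l_def sum.distrib
      by (subst sum.swap) (simp add: expo_size_def sum_distrib_right)
    moreover have "(\<Sum>\<alpha>\<in>Delta d f. (real d - real (expo_size \<alpha>)) * t \<alpha>)
        + (\<Sum>\<alpha>\<in>Delta d f. real (expo_size \<alpha>) * t \<alpha>)
        = (\<Sum>\<alpha>\<in>Delta d f. \<bar>coef f \<alpha>\<bar> * monom_at N \<alpha>)"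
      unfolding sum.distrib[symmetric]
    proof (rule sum.cong)
      fix \<alpha>
      have "real d * t \<alpha> = \<bar>coef f \<alpha>\<bar> * monom_at N \<alpha>" using d by (simp add: t_def)
      then show "(real d - real (expo_size \<alpha>)) * t \<alpha> + real (expo_size \<alpha>) * t \<alpha>
          = \<bar>coef f \<alpha>\<bar> * monom_at N \<alpha>"
        by (simp flip: distrib_right)
    qed simp
    ultimately show ?thesis by (simp add: f_tr_eq[OF d(2,1,3)])
  qed
  ultimately show ?thesis by (rule that)
qed

text \<open>
  As the constant term is finite, the infimum turns into a supremum of real values. For an empty
  feasible set both sides are \<open>-\<infinity>\<close>.
\<close>

lemma h_gp_G_lam:
  assumes "0 < d"
  shows "h_gp d (G_lam f (box_constraints d N) l) =
    (SUP z\<in>gp_feasible d (G_lam f (box_constraints d N) l).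
      ereal (coef f 0 - (\<Sum>i\<in>UNIV. l i) - gp_objective d f z))"
proof -
  let ?c = "coef f 0 - (\<Sum>i\<in>UNIV. l i)"
  let ?F = "gp_feasible d (G_lam f (box_constraints d N) l)"
  have "(SUP z\<in>?F. ereal (?c - gp_objective d f z))
      = ereal ?c - (INF z\<in>?F. ereal (gp_objective d f z))"
  proof (cases "?F = {}")
    case True
    then show ?thesis by (simp add: top_ereal_def bot_ereal_def)
  next
    case False
    then show ?thesis
      using SUP_ereal_minus_right[of ?F "ereal ?c" "\<lambda>z. ereal (gp_objective d f z)"] by simp
  qed
  then show ?thesis
    by (simp add: h_gp_def gp_rho_def gp_objective_G_lam coef_G_lam_0[OF assms])
qed

theorem theorem4p1:
  fixes f :: "('n::finite) rpoly" and N :: "'n \<Rightarrow> real" and d :: nat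
  assumes "\<And>i. N i > 0"
    and "even d"
    and "d \<ge> max 2 (total_degree f)"
  shows "s_bound d f (box_constraints d N) \<ge> ereal (f_tr f N)
    \<and> ((\<forall>i. coef f (eps d i) \<le> 0) \<longrightarrow>
          s_bound d f (box_constraints d N) = ereal (f_tr f N))
    \<and> (total_degree f < d \<longrightarrow>
          s_bound d f (box_constraints d N) = ereal (f_tr f N))"
proof -
  have d: "0 < d" "even d" "total_degree f \<le> d" using assms by auto
  let ?G = "G_lam f (box_constraints d N)"
  have lower: "ereal (f_tr f N) \<le> s_bound d f (box_constraints d N)"
  proof -
    obtain l z where l: "\<forall>i. 0 \<le> l i" and z: "z \<in> gp_feasible d (?G l)"
      and eq: "coef f 0 - (\<Sum>i\<in>UNIV. l i) - gp_objective d f z = f_tr f N"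
      using gp_value_attains_f_tr[where N = N, OF assms(1) d] .
    have "ereal (f_tr f N) \<le> h_gp d (?G l)"
      unfolding h_gp_G_lam[OF d(1)] eq[symmetric] by (rule SUP_upper) (rule z)
    also have "\<dots> \<le> s_bound d f (box_constraints d N)"
      unfolding s_bound_def using l by (intro SUP_upper) auto
    finally show ?thesis .
  qed
  have equal: "s_bound d f (box_constraints d N) = ereal (f_tr f N)"
    if neg: "\<And>i. coef f (eps d i) \<le> 0"
  proof (rule antisym[OF _ lower])
    show "s_bound d f (box_constraints d N) \<le> ereal (f_tr f N)"
      unfolding s_bound_def h_gp_G_lam[OF d(1)]
      using gp_value_le_f_tr[where N = N, OF assms(1) d neg] by (intro SUP_least) auto
  qed
  moreover have "coef f (eps d i) \<le> 0" if "total_degree f < d" for i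
    using coef_eq_zero_of_total_degree[of f "eps d i"] that by simp
  ultimately show ?thesis using lower by blast
qed

end
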